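(* Let $\mathbb{K}$ be a field of characteristic zero. Let $Z\subset\mathbb{P}^2=\mathbb{P}^2(\mathbb{K})$ be a set of $9$ distinct points such that there exist three lines each passing through $4$ points of $Z$ and four lines each passing through $3$ points of $Z$. Then for a general point $B\in\mathbb{P}^2$ there exists a quartic curve passing through all points of $Z$ and having a triple point at $B$; that is, there is a nonzero form of degree $4$ that vanishes on $Z$ and vanishes to order at least $3$ at $B$.
   Context: The seven lines are distinct; the first three contain exactly $4$ points of $Z$ each and the other four contain exactly $3$ points of $Z$ each. "General" means: for all $B$ in some nonempty Zariski open subset of $\mathbb{P}^2$. *)

theory Defs
  imports "HOL-Analysis.Analysis" "HOL-Library.Poly_Mapping"
begin

section \<open>Ternary polynomials\<close>

type_synonym monom3 = "3 \<Rightarrow>\<^sub>0 nat"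
type_synonym 'a poly3 = "monom3 \<Rightarrow>\<^sub>0 'a"

definition mdeg :: "monom3 \<Rightarrow> nat" where
  "mdeg m = (\<Sum>i\<in>UNIV. Poly_Mapping.lookup m i)"

definition Const3 :: "'a::comm_ring_1 \<Rightarrow> 'a poly3" where
  "Const3 c = Poly_Mapping.single 0 c"

definition Var3 :: "3 \<Rightarrow> 'a::comm_ring_1 poly3" where
  "Var3 i = Poly_Mapping.single (Poly_Mapping.single i 1) 1"

definition eval3 :: "'a::comm_ring_1 poly3 \<Rightarrow> 'a^3 \<Rightarrow> 'a" where
  "eval3 F v = (\<Sum>m\<in>Poly_Mapping.keys F.
     Poly_Mapping.lookup F m * (\<Prod>i\<in>UNIV. (v $ i) ^ Poly_Mapping.lookup m i))"

text \<open>The zero polynomial is a form of every degree.\<close>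

definition is_form :: "nat \<Rightarrow> 'a::comm_ring_1 poly3 \<Rightarrow> bool" where
  "is_form d F \<longleftrightarrow> (\<forall>m\<in>Poly_Mapping.keys F. mdeg m = d)"

text \<open>The polynomial \<open>F(v + Y)\<close> in the variables \<open>Y\<close>, i.e. the Taylor expansion
  of \<open>F\<close> at \<open>v\<close>.\<close>

definition taylor3 :: "'a::comm_ring_1 poly3 \<Rightarrow> 'a^3 \<Rightarrow> 'a poly3" where
  "taylor3 F v = (\<Sum>m\<in>Poly_Mapping.keys F.
     Const3 (Poly_Mapping.lookup F m) *
     (\<Prod>i\<in>UNIV. (Const3 (v $ i) + Var3 i) ^ Poly_Mapping.lookup m i))"

section \<open>The projective plane\<close>

typedef (overloaded) 'a proj_plane = "{vec.span {v} | v :: 'a::field ^ 3. v \<noteq> 0}"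
  morphisms subspace_of proj_of
proof -
  have "(axis 1 1 :: 'a ^ 3) \<noteq> 0"
    by (simp add: axis_eq_0_iff)
  then show ?thesis by blast
qed

definition reps :: "'a::field proj_plane \<Rightarrow> ('a^3) set" where
  "reps P = subspace_of P - {0}"

definition is_line :: "'a::field proj_plane set \<Rightarrow> bool" where
  "is_line L \<longleftrightarrow> (\<exists>a :: 'a^3. a \<noteq> 0 \<and>
     L = {P. \<forall>v\<in>reps P. (\<Sum>i\<in>UNIV. a $ i * v $ i) = 0})"

definition vanishes_at :: "'a::field poly3 \<Rightarrow> 'a proj_plane \<Rightarrow> bool" where
  "vanishes_at F P \<longleftrightarrow> (\<forall>v\<in>reps P. eval3 F v = 0)"

text \<open>For a form \<open>F\<close> the order of \<open>F\<close> at a homogeneous coordinate vector of \<open>P\<close> does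
  not depend on that vector, and it is the order at \<open>P\<close> of a local equation of the
  curve \<open>F = 0\<close> in any affine chart: by homogeneity, \<open>F\<close> is up to a unit the pullback
  of that local equation.\<close>

definition vanishes_to_order_at :: "nat \<Rightarrow> 'a::field poly3 \<Rightarrow> 'a proj_plane \<Rightarrow> bool" where
  "vanishes_to_order_at k F P \<longleftrightarrow>
     (\<forall>v\<in>reps P. \<forall>m\<in>Poly_Mapping.keys (taylor3 F v). k \<le> mdeg m)"

definition zariski_closed :: "'a::field proj_plane set \<Rightarrow> bool" where
  "zariski_closed C \<longleftrightarrow> (\<exists>S :: 'a poly3 set.
     (\<forall>F\<in>S. \<exists>d. is_form d F) \<and> C = {P. \<forall>F\<in>S. vanishes_at F P})"

definition zariski_open :: "'a::field proj_plane set \<Rightarrow> bool" where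
  "zariski_open U \<longleftrightarrow> zariski_closed (- U)"

end

theory Submission imports Defs begin

text \<open>The hypotheses on \<open>Z\<close> leave only one configuration up to a change of coordinates, the
  one coming from the root system \<open>B\<^sub>3\<close>: the vertices of the coordinate triangle together
  with the six points \<open>(0 : 1 : \<plusminus>1)\<close>, \<open>(\<plusminus>1 : 0 : 1)\<close>, \<open>(1 : \<plusminus>1 : 0)\<close>.  For this configuration
  there is an explicit quartic.  With \<open>b\<close> a coordinate vector of \<open>B\<close> and \<open>\<times>\<close> the cross product,
  it is
  \<open>Q\<^sub>b(X) = (\<Sum>i. X\<^sub>i (b \<times> X)\<^sub>i ^ 3)\<close>.
  Since \<open>b \<times> (t b + Y) = b \<times> Y\<close>, every summand of \<open>Q\<^sub>b(t b + Y)\<close> contains the cube of a linear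
  form in \<open>Y\<close>, so \<open>Q\<^sub>b\<close> has a triple point at \<open>B\<close>.  On the line \<open>X\<^sub>1 = 0\<close> it restricts to
  \<open>b\<^sub>1 ^ 3 X\<^sub>2 X\<^sub>3 (X\<^sub>2 ^ 2 - X\<^sub>3 ^ 2)\<close>, and cyclically on the other two sides; this shows both that
  \<open>Q\<^sub>b\<close> vanishes on \<open>Z\<close> and, as \<open>b \<noteq> 0\<close> and the characteristic is zero, that \<open>Q\<^sub>b \<noteq> 0\<close>.  The
  construction works for every \<open>B\<close>, so the open set is the whole plane.  This half is
  \<open>quartic_with_triple_point\<close>.

  The normal form is \<open>B3_normal_form\<close>.  Three lines with four points each, pairwise sharing at
  most one point, fit into nine points only if they form a triangle whose vertices lie in \<open>Z\<close> and
  whose sides contain all of \<open>Z\<close> (\<open>triangle_of_four_sets\<close>).  The equations of the sides serve as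
  coordinates, and two points of \<open>Z\<close> remain inside each side.  A further line with three points
  of \<open>Z\<close> must take one of these two from each side, and the four such lines realise all four
  pairs on two given sides (\<open>transversals_cover\<close>).  By Menelaus' theorem
  (\<open>collinear_on_sides\<close>) collinearity says that the product of the three coordinate ratios is
  \<open>-1\<close>; four such equations force the two ratios on each side to be opposite
  (\<open>ratios_up_to_sign\<close>), and rescaling the coordinates turns all of them into \<open>\<plusminus>1\<close>.

  No inverse change of coordinates is applied to polynomials: the quartic is \<open>Q\<^sub>b\<close> with the three
  linear forms substituted for the variables.\<close>

section \<open>Substitution into ternary polynomials\<close>

text \<open>Evaluation and Taylor expansion are both substitutions, into the ground ring and into the
  polynomial ring respectively; hence one proof of multiplicativity serves for both.\<close>

definition subst3 :: "('a::comm_ring_1 \<Rightarrow> 'b::comm_ring_1) \<Rightarrow> (3 \<Rightarrow> 'b) \<Rightarrow> 'a poly3 \<Rightarrow> 'b" where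
  "subst3 h x F = (\<Sum>m\<in>Poly_Mapping.keys F.
     h (Poly_Mapping.lookup F m) * (\<Prod>i\<in>UNIV. x i ^ Poly_Mapping.lookup m i))"

lemma eval3_eq_subst3: "eval3 F v = subst3 (\<lambda>c. c) (\<lambda>i. v $ i) F"
  by (simp add: eval3_def subst3_def)

lemma taylor3_eq_subst3: "taylor3 F v = subst3 Const3 (\<lambda>i. Const3 (v $ i) + Var3 i) F"
  by (simp add: taylor3_def subst3_def)

lemma poly3_induct [case_names zero add_single]:
  fixes F :: "'a::comm_ring_1 poly3"
  assumes "P 0" and step: "\<And>F m c. P F \<Longrightarrow> P (F + Poly_Mapping.single m c)"
  shows "P F"
proof (induction F rule: Poly_Mapping.update_induct)
  case const
  then show ?case by (fact assms(1))
next
  case (update F m c)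
  have "Poly_Mapping.update m c F = F + Poly_Mapping.single m c"
    using update.hyps
    by (intro poly_mapping_eqI)
      (auto simp: lookup_update lookup_add lookup_single in_keys_iff when_def)
  then show ?case using step[OF update.IH] by simp
qed

locale coeff_hom =
  fixes h :: "'a::comm_ring_1 \<Rightarrow> 'b::comm_ring_1"
  assumes h_add: "h (a + b) = h a + h b"
    and h_mult: "h (a * b) = h a * h b"
    and h_one: "h 1 = 1"
begin

lemma h_zero: "h 0 = 0"
  using h_add[of 0 0] by simp

lemma subst3_superset:
  assumes "finite A" "Poly_Mapping.keys F \<subseteq> A"
  shows "subst3 h x F =
    (\<Sum>m\<in>A. h (Poly_Mapping.lookup F m) * (\<Prod>i\<in>UNIV. x i ^ Poly_Mapping.lookup m i))"
  unfolding subst3_def using assms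
  by (intro sum.mono_neutral_left) (auto simp: h_zero in_keys_iff)

lemma subst3_add: "subst3 h x (F + G) = subst3 h x F + subst3 h x G"
proof -
  let ?A = "Poly_Mapping.keys F \<union> Poly_Mapping.keys G"
  have "Poly_Mapping.keys (F + G) \<subseteq> ?A" by (rule Poly_Mapping.keys_add)
  then show ?thesis
    by (simp add: subst3_superset[of ?A] lookup_add h_add distrib_right sum.distrib)
qed

lemma subst3_zero: "subst3 h x 0 = 0"
  by (simp add: subst3_def)

lemma subst3_single:
  "subst3 h x (Poly_Mapping.single m c) = h c * (\<Prod>i\<in>UNIV. x i ^ Poly_Mapping.lookup m i)"
  by (simp add: subst3_superset[of "{m}"])

lemma subst3_single_mult:
  "subst3 h x (Poly_Mapping.single m c * G) = subst3 h x (Poly_Mapping.single m c) * subst3 h x G"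
  by (induction G rule: poly3_induct)
    (simp_all add: subst3_zero subst3_add distrib_left mult_single subst3_single lookup_add
      power_add prod.distrib h_mult mult_ac)

lemma subst3_mult: "subst3 h x (F * G) = subst3 h x F * subst3 h x G"
  by (induction F rule: poly3_induct)
    (simp_all add: subst3_zero subst3_add distrib_right subst3_single_mult)

lemma subst3_diff: "subst3 h x (F - G) = subst3 h x F - subst3 h x G"
  using subst3_add[of x "F - G" G] by simp

lemma subst3_Const3: "subst3 h x (Const3 c) = h c"
  by (simp add: Const3_def subst3_single)

lemma subst3_Var3: "subst3 h x (Var3 i) = x i"
proof -
  have "(\<Prod>j\<in>UNIV. x j ^ Poly_Mapping.lookup (Poly_Mapping.single i 1) j)
      = (\<Prod>j\<in>UNIV. if j = i then x j else 1)"
    by (intro prod.cong) (auto simp: lookup_single when_def)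
  then show ?thesis by (simp add: Var3_def subst3_single h_one)
qed

end

lemma Const3_add: "Const3 (a + b) = Const3 a + Const3 b"
  by (simp add: Const3_def single_add)

lemma Const3_mult: "Const3 (a * b) = Const3 a * Const3 b"
  by (simp add: Const3_def mult_single)

interpretation eval_hom: coeff_hom "\<lambda>c::'a::comm_ring_1. c"
  by unfold_locales simp_all

interpretation taylor_hom: coeff_hom "Const3 :: 'a::comm_ring_1 \<Rightarrow> 'a poly3"
  by unfold_locales (simp_all add: Const3_add Const3_mult, simp add: Const3_def)

section \<open>Degrees and orders\<close>

lemma mdeg_add: "mdeg (m + n) = mdeg m + mdeg n"
  by (simp add: mdeg_def lookup_add sum.distrib)

lemma is_form_add: "is_form d F \<Longrightarrow> is_form d G \<Longrightarrow> is_form d (F + G)"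
  using Poly_Mapping.keys_add[of F G] unfolding is_form_def by blast

lemma is_form_diff: "is_form d F \<Longrightarrow> is_form d G \<Longrightarrow> is_form d (F - G)"
  using keys_diff[of F G] unfolding is_form_def by blast

lemma is_form_mult: "is_form d F \<Longrightarrow> is_form e G \<Longrightarrow> is_form (d + e) (F * G)"
  using keys_mult[of F G] unfolding is_form_def by (fastforce simp: mdeg_add)

lemma is_form_Const3: "is_form 0 (Const3 c)"
  by (simp add: is_form_def Const3_def mdeg_def)

lemma is_form_Var3: "is_form 1 (Var3 i)"
proof -
  have "mdeg (Poly_Mapping.single i 1) = (\<Sum>j\<in>UNIV. if j = i then 1 else 0)"
    unfolding mdeg_def by (intro sum.cong) (auto simp: lookup_single when_def)
  then show ?thesis by (simp add: is_form_def Var3_def)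
qed

lemma is_form_scale: "is_form d F \<Longrightarrow> is_form d (Const3 c * F)"
  using is_form_mult[OF is_form_Const3] by fastforce

lemma is_form_cube: "is_form 1 F \<Longrightarrow> is_form 3 (F ^ 3)"
  using is_form_mult[OF is_form_mult, of 1 F 1 F 1 F]
  by (simp add: power3_eq_cube numeral_3_eq_3 mult.assoc)

text \<open>The condition on the Taylor expansion in the definition of the multiplicity at a point, on its
  own because it is preserved by sums and, unlike being a form, by arbitrary multiples.\<close>

definition order_ge :: "nat \<Rightarrow> 'a::comm_ring_1 poly3 \<Rightarrow> bool" where
  "order_ge k F \<longleftrightarrow> (\<forall>m\<in>Poly_Mapping.keys F. k \<le> mdeg m)"

lemma order_ge_add: "order_ge k F \<Longrightarrow> order_ge k G \<Longrightarrow> order_ge k (F + G)"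
  using Poly_Mapping.keys_add[of F G] unfolding order_ge_def by blast

lemma order_ge_mult_form: "is_form k G \<Longrightarrow> order_ge k (F * G)"
  using keys_mult[of F G] unfolding is_form_def order_ge_def by (fastforce simp: mdeg_add)

section \<open>Linear algebra in three dimensions\<close>

definition dot :: "'a::comm_ring_1^3 \<Rightarrow> 'a^3 \<Rightarrow> 'a" where
  "dot a v = (\<Sum>i\<in>UNIV. a $ i * v $ i)"

definition cross :: "'a::comm_ring_1^3 \<Rightarrow> 'a^3 \<Rightarrow> 'a^3" where
  "cross v w = vector [v$2 * w$3 - v$3 * w$2, v$3 * w$1 - v$1 * w$3, v$1 * w$2 - v$2 * w$1]"

definition det3 :: "'a::comm_ring_1^3 \<Rightarrow> 'a^3 \<Rightarrow> 'a^3 \<Rightarrow> 'a" where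
  "det3 a b c = dot a (cross b c)"

lemmas vec3_simps = dot_def cross_def det3_def sum_3 vector_3 vec_eq_iff forall_3

lemma dot_scale_left: "dot (c *s a) v = c * dot a v"
  by (simp add: vec3_simps algebra_simps)

lemma dot_scale_right: "dot a (c *s v) = c * dot a v"
  by (simp add: vec3_simps algebra_simps)

lemma dot_diff_right: "dot a (v - w) = dot a v - dot a w"
  by (simp add: vec3_simps algebra_simps)

lemma det3_scale: "det3 (r *s a) (s *s b) (t *s c) = r * s * t * det3 a b c"
  by (simp add: vec3_simps algebra_simps)

lemma cross_eq_zero_imp_proportional:
  fixes v w :: "'a::field^3"
  assumes "cross v w = 0" "v \<noteq> 0"
  obtains c where "w = c *s v"
proof -
  have e: "v$2 * w$3 = v$3 * w$2" "v$3 * w$1 = v$1 * w$3" "v$1 * w$2 = v$2 * w$1"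
    using assms(1) by (simp_all add: vec3_simps)
  obtain i where i: "v $ i \<noteq> 0" using assms(2) by (auto simp: vec_eq_iff)
  have "\<forall>i j. v $ i * w $ j = v $ j * w $ i"
    unfolding forall_3 using e by (simp add: mult.commute)
  then have "v $ i * w $ j = v $ j * w $ i" for j by blast
  then have "w = (w $ i / v $ i) *s v"
    using i by (simp add: vec_eq_iff field_simps)
  then show ?thesis by (rule that)
qed

text \<open>Over an arbitrary field, two vectors orthogonal to \<open>a\<close> determine \<open>a\<close> up to a scalar as their
  cross product: this is the expansion of the double cross product.\<close>

lemma orthogonal_imp_cross_zero:
  assumes "dot a v = 0" "dot a w = 0"
  shows "cross (cross v w) a = 0"
proof -
  have "cross (cross v w) a = dot a v *s w - dot a w *s v"
    by (simp add: vec3_simps algebra_simps)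
  then show ?thesis using assms by simp
qed

text \<open>Cramer's rule: each coordinate of \<open>a\<close>, times the determinant, is a combination of the three
  vanishing products.\<close>

lemma orthogonal_imp_det3_zero:
  fixes a :: "'a::field^3"
  assumes "dot a p = 0" "dot a q = 0" "dot a r = 0" "a \<noteq> 0"
  shows "det3 p q r = 0"
proof -
  have "det3 p q r *s a = dot a p *s cross q r + dot a q *s cross r p + dot a r *s cross p q"
    by (simp add: vec3_simps algebra_simps)
  then have "det3 p q r *s a = 0" using assms by simp
  then show ?thesis using assms(4) by (simp add: vector_mul_eq_0)
qed

lemma det3_nonzero_imp_injective:
  fixes v :: "'a::field^3"
  assumes "det3 a b c \<noteq> 0" "dot a v = 0" "dot b v = 0" "dot c v = 0"
  shows "v = 0"
proof -
  have "det3 a b c *s v = dot a v *s cross b c + dot b v *s cross c a + dot c v *s cross a b"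
    by (simp add: vec3_simps algebra_simps)
  then have "det3 a b c *s v = 0" using assms by simp
  then show ?thesis using assms(1) by (simp add: vector_mul_eq_0)
qed

lemma det3_nonzero_imp_surjective:
  fixes a b c :: "'a::field^3"
  assumes "det3 a b c \<noteq> 0"
  obtains w where "dot a w = x" "dot b w = y" "dot c w = z"
proof -
  define w0 where "w0 = x *s cross b c + y *s cross c a + z *s cross a b"
  define w where "w = (1 / det3 a b c) *s w0"
  have "dot a w0 = det3 a b c * x" "dot b w0 = det3 a b c * y" "dot c w0 = det3 a b c * z"
    by (simp_all add: w0_def vec3_simps algebra_simps)
  with that[of w] show ?thesis using assms by (simp add: w_def dot_scale_right)
qed

text \<open>Multiplicativity of the determinant, read as the effect of the change of coordinates given by
  the linear forms \<open>a\<close>, \<open>b\<close>, \<open>c\<close> on the determinant of three points.\<close>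

lemma det3_mult:
  "det3 (vector [dot a p, dot b p, dot c p]) (vector [dot a q, dot b q, dot c q])
     (vector [dot a r, dot b r, dot c r]) = det3 a b c * det3 p q r"
  by (simp add: vec3_simps algebra_simps)

section \<open>Points and lines\<close>

lemma reps_imp_span:
  assumes "v \<in> reps P"
  shows "v \<noteq> 0" "subspace_of P = vec.span {v}"
proof -
  show "v \<noteq> 0" using assms by (simp add: reps_def)
  obtain u where u: "subspace_of P = vec.span {u}" using subspace_of[of P] by blast
  then obtain c where c: "v = c *s u"
    using assms by (auto simp: reps_def vec.span_singleton)
  with \<open>v \<noteq> 0\<close> have "c \<noteq> 0" by auto
  have "vec.span {u} = vec.span {v}"
    unfolding vec.span_singleton c
  proof (intro equalityI subsetI)
    fix y assume "y \<in> range (\<lambda>k. k *s u)"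
    then obtain k where "y = k *s u" by blast
    then have "y = (k / c) *s (c *s u)" using \<open>c \<noteq> 0\<close> by simp
    then show "y \<in> range (\<lambda>k. k *s (c *s u))" by blast
  qed auto
  then show "subspace_of P = vec.span {v}" using u by simp
qed

lemma reps_eq:
  assumes "v \<in> reps P"
  shows "reps P = {c *s v | c. c \<noteq> 0}"
  using reps_imp_span[OF assms] by (auto simp: reps_def vec.span_singleton)

lemma reps_nonempty: obtains v where "v \<in> reps P"
proof -
  obtain u where u: "u \<noteq> 0" "subspace_of P = vec.span {u}" using subspace_of[of P] by blast
  then have "u \<in> reps P" by (simp add: reps_def vec.span_base)
  then show ?thesis by (rule that)
qed

lemma reps_proportional_imp_eq:
  assumes "v \<in> reps P" "w \<in> reps Q" "w = c *s v"
  shows "P = Q"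
proof -
  have "c \<noteq> 0" using assms reps_imp_span(1)[OF assms(2)] by auto
  then have "w \<in> reps P" using reps_eq[OF assms(1)] assms(3) by blast
  then have "subspace_of P = subspace_of Q" using reps_imp_span(2) assms(2) by metis
  then show ?thesis by (simp add: subspace_of_inject)
qed

definition line_of :: "'a::field^3 \<Rightarrow> 'a proj_plane set" where
  "line_of a = {P. \<forall>v\<in>reps P. dot a v = 0}"

lemma is_line_iff: "is_line L \<longleftrightarrow> (\<exists>a. a \<noteq> 0 \<and> L = line_of a)"
  by (simp add: is_line_def line_of_def dot_def)

lemma in_line_of_iff: "v \<in> reps P \<Longrightarrow> P \<in> line_of a \<longleftrightarrow> dot a v = 0"
  by (auto simp: line_of_def reps_eq dot_scale_right)

lemma line_of_scale: "c \<noteq> 0 \<Longrightarrow> line_of (c *s a) = line_of a"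
  by (simp add: line_of_def dot_scale_left)

text \<open>The coefficient vector of a line through two points is proportional to the cross product of
  their coordinate vectors.\<close>

lemma line_unique:
  assumes "is_line L" "is_line L'" "P \<noteq> Q" "P \<in> L" "Q \<in> L" "P \<in> L'" "Q \<in> L'"
  shows "L = L'"
proof -
  obtain p q where pq: "p \<in> reps P" "q \<in> reps Q" by (meson reps_nonempty)
  have c: "cross p q \<noteq> 0"
    using cross_eq_zero_imp_proportional reps_imp_span(1)[OF pq(1)]
      reps_proportional_imp_eq[OF pq] assms(3) by metis
  have "M = line_of (cross p q)" if M: "is_line M" "P \<in> M" "Q \<in> M" for M
  proof -
    obtain a where a: "a \<noteq> 0" "M = line_of a" using M(1) is_line_iff by blast
    then have "dot a p = 0" "dot a q = 0" using M pq in_line_of_iff by blast+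
    then obtain k where "a = k *s cross p q"
      using cross_eq_zero_imp_proportional[OF orthogonal_imp_cross_zero c] by blast
    with a show ?thesis using line_of_scale by (metis vector_mul_eq_0)
  qed
  then show ?thesis using assms by metis
qed

section \<open>The quartic\<close>

text \<open>Over an arbitrary commutative ring, so that the same formula gives the polynomial, its values
  and its Taylor expansion.\<close>

definition quartic :: "'r::comm_ring_1 \<Rightarrow> 'r \<Rightarrow> 'r \<Rightarrow> 'r \<Rightarrow> 'r \<Rightarrow> 'r \<Rightarrow> 'r" where
  "quartic b1 b2 b3 x y z =
     x * (b2 * z - b3 * y) ^ 3 + y * (b3 * x - b1 * z) ^ 3 + z * (b1 * y - b2 * x) ^ 3"

text \<open>Translation along \<open>b\<close> does not change the cross product with \<open>b\<close>.\<close>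

lemma quartic_translate:
  "quartic b1 b2 b3 (t * b1 + x) (t * b2 + y) (t * b3 + z) =
     (t * b1 + x) * (b2 * z - b3 * y) ^ 3 + (t * b2 + y) * (b3 * x - b1 * z) ^ 3
     + (t * b3 + z) * (b1 * y - b2 * x) ^ 3"
proof -
  have "b2 * (t * b3 + z) - b3 * (t * b2 + y) = b2 * z - b3 * y"
    "b3 * (t * b1 + x) - b1 * (t * b3 + z) = b3 * x - b1 * z"
    "b1 * (t * b2 + y) - b2 * (t * b1 + x) = b1 * y - b2 * x"
    by (simp_all add: algebra_simps)
  then show ?thesis by (simp only: quartic_def)
qed

text \<open>Over a field: all coordinate vectors of the nine points of the \<open>B\<^sub>3\<close> configuration, and the zero
  vector.  Two vanishing coordinates give a vertex of the triangle.\<close>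

definition B3_coords :: "'a::comm_ring_1 \<Rightarrow> 'a \<Rightarrow> 'a \<Rightarrow> bool" where
  "B3_coords x y z \<longleftrightarrow> (x = 0 \<and> (y = 0 \<or> z = 0 \<or> y\<^sup>2 = z\<^sup>2)) \<or>
     (y = 0 \<and> (z = 0 \<or> x = 0 \<or> z\<^sup>2 = x\<^sup>2)) \<or> (z = 0 \<and> (x = 0 \<or> y = 0 \<or> x\<^sup>2 = y\<^sup>2))"

text \<open>On each side of the triangle the quartic is a constant times four linear factors, one for each
  of the four points of the configuration there.\<close>

lemma quartic_B3_zero:
  assumes "B3_coords x y z"
  shows "quartic b1 b2 b3 x y z = 0"
proof -
  have "quartic b1 b2 b3 0 y z = b1 ^ 3 * y * z * (y\<^sup>2 - z\<^sup>2)"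
    "quartic b1 b2 b3 x 0 z = b2 ^ 3 * z * x * (z\<^sup>2 - x\<^sup>2)"
    "quartic b1 b2 b3 x y 0 = b3 ^ 3 * x * y * (x\<^sup>2 - y\<^sup>2)"
    by (simp_all add: quartic_def power2_eq_square power3_eq_cube algebra_simps)
  with assms show ?thesis unfolding B3_coords_def by auto
qed

definition lin :: "'a::comm_ring_1^3 \<Rightarrow> 'a poly3" where
  "lin a = (\<Sum>i\<in>UNIV. Const3 (a $ i) * Var3 i)"

lemma is_form_lin: "is_form 1 (lin a)"
  unfolding lin_def sum_3 by (intro is_form_add is_form_scale is_form_Var3)

lemma (in coeff_hom) subst3_quartic:
  "subst3 h u (quartic (Const3 b1) (Const3 b2) (Const3 b3) F G H) =
     quartic (h b1) (h b2) (h b3) (subst3 h u F) (subst3 h u G) (subst3 h u H)"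
  by (simp add: quartic_def power3_eq_cube subst3_add subst3_diff subst3_mult subst3_Const3)

lemma eval3_lin: "eval3 (lin a) v = dot a v"
  by (simp add: eval3_eq_subst3 lin_def dot_def sum_3 eval_hom.subst3_add eval_hom.subst3_mult
      eval_hom.subst3_Const3 eval_hom.subst3_Var3)

lemma taylor3_lin: "taylor3 (lin a) v = Const3 (dot a v) + lin a"
  by (simp add: taylor3_eq_subst3 lin_def dot_def sum_3 taylor_hom.subst3_add
      taylor_hom.subst3_mult taylor_hom.subst3_Const3 taylor_hom.subst3_Var3
      Const3_add Const3_mult algebra_simps)

lemma quartic_with_triple_point:
  fixes a1 a2 a3 :: "'a::field_char_0^3"
  assumes det: "det3 a1 a2 a3 \<noteq> 0"
    and Z: "\<forall>P\<in>Z. \<forall>v\<in>reps P. B3_coords (dot a1 v) (dot a2 v) (dot a3 v)"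
  shows "\<exists>F. F \<noteq> 0 \<and> is_form 4 F \<and> (\<forall>P\<in>Z. vanishes_at F P) \<and> vanishes_to_order_at 3 F B"
proof -
  obtain b where b: "b \<in> reps B" by (rule reps_nonempty)
  define b1 b2 b3 where "b1 = dot a1 b" and "b2 = dot a2 b" and "b3 = dot a3 b"
  define F where
    "F = quartic (Const3 b1) (Const3 b2) (Const3 b3) (lin a1) (lin a2) (lin a3)"
  have eval: "eval3 F v = quartic b1 b2 b3 (dot a1 v) (dot a2 v) (dot a3 v)" for v
    unfolding F_def eval3_eq_subst3 eval_hom.subst3_quartic
    by (simp add: eval3_eq_subst3[symmetric] eval3_lin)
  have cube: "is_form 3 ((Const3 x * lin s - Const3 y * lin t) ^ 3)" for x y and s t :: "'a^3"
    by (intro is_form_cube is_form_diff is_form_scale is_form_lin)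
  have "is_form 4 (lin r * (Const3 x * lin s - Const3 y * lin t) ^ 3)"
    for x y and r s t :: "'a^3"
    using is_form_mult[OF is_form_lin cube] by simp
  then have "is_form 4 F" unfolding F_def quartic_def by (intro is_form_add)
  moreover have "\<forall>P\<in>Z. vanishes_at F P"
    using Z by (simp add: vanishes_at_def eval quartic_B3_zero)
  moreover have "vanishes_to_order_at 3 F B"
    unfolding vanishes_to_order_at_def
  proof
    fix v assume "v \<in> reps B"
    \<comment> \<open>The quartic is built from the fixed vector \<open>b\<close>, but the multiplicity refers to all \<open>v\<close>.\<close>
    then obtain t where v: "v = t *s b" using reps_eq[OF b] by blast
    have "taylor3 F v = quartic (Const3 b1) (Const3 b2) (Const3 b3)
        (Const3 t * Const3 b1 + lin a1) (Const3 t * Const3 b2 + lin a2)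
        (Const3 t * Const3 b3 + lin a3)"
      unfolding F_def taylor3_eq_subst3 taylor_hom.subst3_quartic
      by (simp only: taylor3_eq_subst3[symmetric] taylor3_lin)
        (simp only: v dot_scale_right Const3_mult b1_def b2_def b3_def)
    then have "order_ge 3 (taylor3 F v)"
      unfolding quartic_translate by (simp add: order_ge_add order_ge_mult_form cube)
    then show "\<forall>m\<in>Poly_Mapping.keys (taylor3 F v). 3 \<le> mdeg m" by (simp add: order_ge_def)
  qed
  moreover have "F \<noteq> 0"
  proof
    assume "F = 0"
    then have F0: "eval3 F v = 0" for v by (simp add: eval3_def)
    have vanish: "quartic b1 b2 b3 x y z = 0" for x y z
      using det3_nonzero_imp_surjective[OF det] eval F0 by metis
    \<comment> \<open>At \<open>(0, 1, 2)\<close> the quartic has the value \<open>-6 * b1 ^ 3\<close>, and similarly at the other two.\<close>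
    have "b1 = 0" using vanish[of 0 1 2] by (simp add: quartic_def power3_eq_cube)
    moreover have "b2 = 0" using vanish[of 2 0 1] by (simp add: quartic_def power3_eq_cube)
    moreover have "b3 = 0" using vanish[of 1 2 0] by (simp add: quartic_def power3_eq_cube)
    ultimately have "b = 0"
      using det3_nonzero_imp_injective[OF det] unfolding b1_def b2_def b3_def by blast
    then show False using reps_imp_span(1)[OF b] by simp
  qed
  ultimately show ?thesis by blast
qed

section \<open>Combinatorics of the lines\<close>

text \<open>Inclusion-exclusion: the union has \<open>12 - (p - q)\<close> elements, where \<open>p \<le> 3\<close> counts the pairs of
  sets that meet and \<open>q\<close> the common points; at most nine are available, so \<open>p = 3\<close> and \<open>q = 0\<close>.\<close>

lemma triangle_of_four_sets:
  assumes "card Z = 9" and sub: "A \<subseteq> Z" "B \<subseteq> Z" "C \<subseteq> Z"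
    and card4: "card A = 4" "card B = 4" "card C = 4"
    and le1: "card (A \<inter> B) \<le> 1" "card (A \<inter> C) \<le> 1" "card (B \<inter> C) \<le> 1"
  shows "A \<union> B \<union> C = Z" "card (A \<inter> B) = 1" "card (A \<inter> C) = 1" "card (B \<inter> C) = 1"
    "A \<inter> B \<inter> C = {}"
proof -
  have finZ: "finite Z" using assms(1) card.infinite by fastforce
  have fin: "finite A" "finite B" "finite C" using finite_subset[OF _ finZ] sub by blast+
  have e1: "card (A \<union> B) + card (A \<inter> B) = 8"
    using card_Un_Int[OF fin(1,2)] card4 by simp
  have e2: "card (A \<union> B \<union> C) + card ((A \<inter> C) \<union> (B \<inter> C)) = card (A \<union> B) + 4"
    using card_Un_Int[of "A \<union> B" C] fin card4 by (simp add: Int_Un_distrib2)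
  have e3: "card ((A \<inter> C) \<union> (B \<inter> C)) + card (A \<inter> B \<inter> C) = card (A \<inter> C) + card (B \<inter> C)"
  proof -
    have "(A \<inter> C) \<inter> (B \<inter> C) = A \<inter> B \<inter> C" by blast
    then show ?thesis using card_Un_Int[of "A \<inter> C" "B \<inter> C"] fin by simp
  qed
  have e4: "card (A \<union> B \<union> C) \<le> 9" using card_mono[OF finZ, of "A \<union> B \<union> C"] sub assms(1) by simp
  show "card (A \<inter> B) = 1" "card (A \<inter> C) = 1" "card (B \<inter> C) = 1"
    using e1 e2 e3 e4 le1 by linarith+
  have "card (A \<inter> B \<inter> C) = 0" using e1 e2 e3 e4 le1 by linarith
  then show "A \<inter> B \<inter> C = {}" using fin by simp
  have "card (A \<union> B \<union> C) = card Z" using e1 e2 e3 e4 le1 assms(1) by linarith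
  then show "A \<union> B \<union> C = Z" using sub by (intro card_subset_eq[OF finZ]) simp_all
qed

lemma triangle_side:
  assumes "card A = 4" "card (A \<inter> B) = 1" "card (A \<inter> C) = 1" "A \<inter> B \<inter> C = {}"
  shows "card (A - B - C) = 2"
proof -
  have fin: "finite A" using assms(1) card.infinite by fastforce
  have "card (A \<inter> B \<union> A \<inter> C) = 2"
    using card_Un_disjoint[of "A \<inter> B" "A \<inter> C"] assms fin by (simp add: Int_assoc Int_left_commute)
  moreover have "A - B - C = A - (A \<inter> B \<union> A \<inter> C)" by blast
  ultimately show ?thesis using card_Diff_subset[of "A \<inter> B \<union> A \<inter> C" A] fin assms(1) by simp
qed

text \<open>A transversal missing the part of \<open>A\<close> outside \<open>B\<close> and \<open>C\<close> would lie in \<open>B \<union> C\<close>, where it has at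
  most two points.\<close>

lemma transversal_of_triangle:
  assumes "card T = 3" "T \<subseteq> A \<union> B \<union> C"
    and le1: "card (T \<inter> A) \<le> 1" "card (T \<inter> B) \<le> 1" "card (T \<inter> C) \<le> 1"
  shows "T \<inter> (A - B - C) \<noteq> {}"
proof
  assume e: "T \<inter> (A - B - C) = {}"
  have fin: "finite T" using assms(1) card.infinite by fastforce
  have "T = (T \<inter> B) \<union> (T \<inter> C)" using e assms(2) by blast
  then have "card T \<le> card (T \<inter> B) + card (T \<inter> C)" by (metis card_Un_le)
  then show False using assms(1) le1 by linarith
qed

text \<open>Choosing a point of \<open>S\<close> and a point of \<open>R\<close> on each of the four transversals is an injection
  into the four pairs, hence a bijection.\<close>

lemma transversals_cover:
  assumes "card N = 4" "card S = 2" "card R = 2"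
    and ex: "\<And>T. T \<in> N \<Longrightarrow> T \<inter> S \<noteq> {}" "\<And>T. T \<in> N \<Longrightarrow> T \<inter> R \<noteq> {}"
    and uniq: "\<And>T T' p q. T \<in> N \<Longrightarrow> T' \<in> N \<Longrightarrow> p \<in> T \<inter> T' \<inter> S \<Longrightarrow> q \<in> T \<inter> T' \<inter> R \<Longrightarrow> T = T'"
    and "p \<in> S" "q \<in> R"
  shows "\<exists>T\<in>N. p \<in> T \<and> q \<in> T"
proof -
  have "\<forall>T\<in>N. \<exists>pq. pq \<in> S \<times> R \<and> fst pq \<in> T \<and> snd pq \<in> T" using ex by fastforce
  then obtain f where f: "\<And>T. T \<in> N \<Longrightarrow> f T \<in> S \<times> R \<and> fst (f T) \<in> T \<and> snd (f T) \<in> T"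
    by metis
  have "inj_on f N"
  proof (rule inj_onI)
    fix T T' assume "T \<in> N" "T' \<in> N" "f T = f T'"
    then show "T = T'"
      using f[of T] f[of T'] by (intro uniq[of T T' "fst (f T)" "snd (f T)"]) (auto simp: mem_Times_iff)
  qed
  moreover have "f ` N \<subseteq> S \<times> R" using f by blast
  moreover have "finite (S \<times> R)"
    using assms(2,3) by (intro finite_cartesian_product) (auto intro: card_ge_0_finite)
  ultimately have "f ` N = S \<times> R"
    using assms(1-3) by (intro card_subset_eq) (simp_all add: card_image card_cartesian_product)
  then obtain T where "T \<in> N" "f T = (p, q)" using assms(7,8) by (metis SigmaI imageE)
  then show ?thesis using f[of T] by auto
qed

text \<open>For each of the four pairs the third factor is determined; changing one of the first two
  changes it, so changing both restores it, as \<open>W\<close> has only two elements.  This gives the relations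
  \<open>x0 * y1 = x1 * y0\<close> and \<open>x1 * y1 = x0 * y0\<close>, whose combination is that the squares agree.\<close>

lemma ratios_up_to_sign:
  fixes X Y W :: "'a::field set"
  assumes card: "card X = 2" "card Y = 2" "card W = 2"
    and ex: "\<And>x y. x \<in> X \<Longrightarrow> y \<in> Y \<Longrightarrow> \<exists>w\<in>W. x * y * w = -1"
  shows "\<exists>\<alpha> \<beta> \<gamma>. \<alpha> * \<beta> * \<gamma> = -1 \<and> (\<forall>x\<in>X. x\<^sup>2 = \<alpha>\<^sup>2) \<and> (\<forall>y\<in>Y. y\<^sup>2 = \<beta>\<^sup>2) \<and>
    (\<forall>w\<in>W. w\<^sup>2 = \<gamma>\<^sup>2)"
proof -
  obtain x0 x1 where X: "X = {x0, x1}" "x0 \<noteq> x1" using card(1) by (auto simp: card_2_iff)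
  obtain y0 y1 where Y: "Y = {y0, y1}" "y0 \<noteq> y1" using card(2) by (auto simp: card_2_iff)
  obtain c0 c1 where W: "W = {c0, c1}" "c0 \<noteq> c1" using card(3) by (auto simp: card_2_iff)
  obtain w00 w01 w10 w11 where w: "w00 \<in> W" "w01 \<in> W" "w10 \<in> W" "w11 \<in> W"
    and e: "x0 * y0 * w00 = -1" "x0 * y1 * w01 = -1" "x1 * y0 * w10 = -1" "x1 * y1 * w11 = -1"
    using ex X Y by (metis insertCI)
  have nz: "x0 \<noteq> 0" "x1 \<noteq> 0" "y0 \<noteq> 0" "y1 \<noteq> 0" "w00 \<noteq> 0" "w01 \<noteq> 0" "w10 \<noteq> 0" "w11 \<noteq> 0"
    using e by auto
  have "w00 \<noteq> w01" using e(1,2) nz Y(2) by (metis mult_cancel_left mult_cancel_right)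
  moreover have "w00 \<noteq> w10" using e(1,3) nz X(2) by (metis mult_cancel_left mult_cancel_right)
  moreover have "w01 \<noteq> w11" using e(2,4) nz X(2) by (metis mult_cancel_left mult_cancel_right)
  ultimately have "w10 = w01" "w11 = w00" "W = {w00, w01}" using w W by auto
  then have p: "x0 * y1 = x1 * y0" "x1 * y1 = x0 * y0"
    using e nz by (metis mult_cancel_right)+
  have "x1\<^sup>2 * y1 = x0\<^sup>2 * y1" using p
    by (simp add: power2_eq_square mult.assoc)
  moreover have "y1\<^sup>2 * x1 = y0\<^sup>2 * x1"
  proof -
    have "y1\<^sup>2 * x1 = (x1 * y1) * y1" by (simp add: power2_eq_square mult_ac)
    also have "\<dots> = (x0 * y1) * y0" by (simp only: p(2) mult_ac)
    also have "\<dots> = y0\<^sup>2 * x1" by (simp only: p(1) power2_eq_square mult_ac)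
    finally show ?thesis .
  qed
  ultimately have sq: "x1\<^sup>2 = x0\<^sup>2" "y1\<^sup>2 = y0\<^sup>2" using nz by simp_all
  have "(x0 * y0 * w00)\<^sup>2 = (x0 * y1 * w01)\<^sup>2" using e by simp
  then have "w01\<^sup>2 = w00\<^sup>2" using sq nz by (simp add: power_mult_distrib)
  then have "(\<forall>x\<in>X. x\<^sup>2 = x0\<^sup>2) \<and> (\<forall>y\<in>Y. y\<^sup>2 = y0\<^sup>2) \<and> (\<forall>w\<in>W. w\<^sup>2 = w00\<^sup>2)"
    using sq X Y \<open>W = {w00, w01}\<close> by simp
  with e(1) show ?thesis by blast
qed

section \<open>Normal form of the configuration\<close>

lemma det3_rotate: "det3 b c a = det3 a b c"
  by (simp add: vec3_simps algebra_simps)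

lemma B3_coords_scale:
  "B3_coords x y z \<Longrightarrow> B3_coords (c * x) (c * y) (c * z)"
  unfolding B3_coords_def power_mult_distrib by fastforce

text \<open>Menelaus' theorem for the triangle with sides \<open>a1\<close>, \<open>a2\<close>, \<open>a3\<close>: in the coordinates given by
  these forms, the determinant of three points on the sides has only two nonzero terms.
  The denominators are cleared so that vertices need no separate treatment.\<close>

lemma collinear_on_sides:
  fixes a1 a2 a3 :: "'a::field^3"
  assumes "is_line L" "P \<in> L" "Q \<in> L" "R \<in> L" and reps: "p \<in> reps P" "q \<in> reps Q" "r \<in> reps R"
    and "dot a1 p = 0" "dot a2 q = 0" "dot a3 r = 0"
  shows "dot a2 p * dot a3 q * dot a1 r = - (dot a3 p * dot a1 q * dot a2 r)"
proof -
  obtain a where a: "a \<noteq> 0" "L = line_of a" using assms(1) is_line_iff by blast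
  then have "dot a p = 0" "dot a q = 0" "dot a r = 0" using assms(2-4) reps in_line_of_iff by blast+
  then have "det3 p q r = 0" using orthogonal_imp_det3_zero a(1) by blast
  then have "det3 (vector [0, dot a2 p, dot a3 p]) (vector [dot a1 q, 0, dot a3 q])
      (vector [dot a1 r, dot a2 r, 0]) = 0"
    using det3_mult[of a1 p a2 a3 q r] assms(8-10) by simp
  then have "dot a2 p * dot a3 q * dot a1 r + dot a3 p * dot a1 q * dot a2 r = 0"
    by (simp add: det3_def cross_def dot_def[of "vector _"] sum_3 vector_3 algebra_simps)
  then show ?thesis by (simp add: eq_neg_iff_add_eq_0)
qed

lemma same_ratio_imp_eq:
  fixes a1 a2 a3 :: "'a::field^3"
  assumes "det3 a1 a2 a3 \<noteq> 0" "p \<in> reps P" "q \<in> reps Q" "dot a1 p = 0" "dot a1 q = 0"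
    "dot a3 p \<noteq> 0" "dot a3 q \<noteq> 0" "dot a2 p / dot a3 p = dot a2 q / dot a3 q"
  shows "P = Q"
proof -
  let ?c = "dot a3 q / dot a3 p"
  have "q - ?c *s p = 0"
    by (rule det3_nonzero_imp_injective[OF assms(1)])
      (use assms(4-8) in \<open>simp_all add: dot_diff_right dot_scale_right field_simps\<close>)
  then show ?thesis using reps_proportional_imp_eq[OF assms(2,3)] by simp
qed

lemma card_two_lines:
  assumes "is_line L" "is_line L'" "L \<noteq> L'" "finite Z"
  shows "card ((L \<inter> Z) \<inter> (L' \<inter> Z)) \<le> 1"
  using line_unique[OF assms(1,2)] assms(3,4) by (auto simp: card_le_Suc0_iff_eq)

lemma B3_normal_form:
  fixes Z :: "'a::field proj_plane set"
  assumes Z: "card Z = 9"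
    and M: "card M = 3" "\<And>L. L \<in> M \<Longrightarrow> is_line L \<and> card (L \<inter> Z) = 4"
    and N: "card N = 4" "\<And>L. L \<in> N \<Longrightarrow> is_line L \<and> card (L \<inter> Z) = 3"
  shows "\<exists>a1 a2 a3 :: 'a^3. det3 a1 a2 a3 \<noteq> 0 \<and>
    (\<forall>P\<in>Z. \<forall>v\<in>reps P. B3_coords (dot a1 v) (dot a2 v) (dot a3 v))"
proof -
  have finZ: "finite Z" using Z card.infinite by fastforce
  obtain L1 L2 L3 where M_eq: "M = {L1, L2, L3}" and ne: "L1 \<noteq> L2" "L1 \<noteq> L3" "L2 \<noteq> L3"
    using M(1) by (auto simp: card_3_iff)
  have line: "is_line L1" "is_line L2" "is_line L3" using M(2) M_eq by auto
  define A B C where "A = L1 \<inter> Z" and "B = L2 \<inter> Z" and "C = L3 \<inter> Z"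
  have card4: "card A = 4" "card B = 4" "card C = 4" using M(2) M_eq by (auto simp: A_def B_def C_def)
  have tri: "A \<union> B \<union> C = Z" "card (A \<inter> B) = 1" "card (A \<inter> C) = 1" "card (B \<inter> C) = 1"
    "A \<inter> B \<inter> C = {}"
    by (rule triangle_of_four_sets[OF Z _ _ _ card4];
        use card_two_lines line ne finZ in \<open>auto simp: A_def B_def C_def\<close>)+
  define S1 S2 S3 where "S1 = A - B - C" and "S2 = B - C - A" and "S3 = C - A - B"
  have card2: "card S1 = 2" "card S2 = 2" "card S3 = 2"
    unfolding S1_def S2_def S3_def
    by (rule triangle_side; use card4 tri in \<open>simp add: Int_ac\<close>)+

  obtain a1 a2 a3 where a: "L1 = line_of a1" "L2 = line_of a2" "L3 = line_of a3"
    using line is_line_iff by metis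
  define r where "r P = (SOME v. v \<in> reps P)" for P :: "'a proj_plane"
  have r: "r P \<in> reps P" for P unfolding r_def by (meson reps_nonempty someI)
  define x y z where "x P = dot a1 (r P)" and "y P = dot a2 (r P)" and "z P = dot a3 (r P)" for P
  have on: "P \<in> L1 \<longleftrightarrow> x P = 0" "P \<in> L2 \<longleftrightarrow> y P = 0" "P \<in> L3 \<longleftrightarrow> z P = 0" for P
    unfolding a x_def y_def z_def using in_line_of_iff[OF r] by auto
  have S: "P \<in> S1 \<longleftrightarrow> P \<in> Z \<and> x P = 0 \<and> y P \<noteq> 0 \<and> z P \<noteq> 0"
    "P \<in> S2 \<longleftrightarrow> P \<in> Z \<and> y P = 0 \<and> z P \<noteq> 0 \<and> x P \<noteq> 0"
    "P \<in> S3 \<longleftrightarrow> P \<in> Z \<and> z P = 0 \<and> x P \<noteq> 0 \<and> y P \<noteq> 0" for P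
    unfolding S1_def S2_def S3_def A_def B_def C_def by (auto simp: on)

  \<comment> \<open>The coordinate vectors of the vertices form a diagonal matrix with nonzero diagonal.\<close>
  have det: "det3 a1 a2 a3 \<noteq> 0"
  proof
    assume 0: "det3 a1 a2 a3 = 0"
    obtain P Q R where "P \<in> B \<inter> C" "Q \<in> A \<inter> C" "R \<in> A \<inter> B"
      using tri by (metis card.empty ex_in_conv zero_neq_one)
    moreover from this have "P \<notin> A" "Q \<notin> B" "R \<notin> C" using tri(5) by blast+
    ultimately have c: "y P = 0" "z P = 0" "x P \<noteq> 0" "x Q = 0" "z Q = 0" "y Q \<noteq> 0"
      "x R = 0" "y R = 0" "z R \<noteq> 0"
      by (auto simp: A_def B_def C_def on)
    have "det3 (vector [x P, y P, z P]) (vector [x Q, y Q, z Q]) (vector [x R, y R, z R]) = 0"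
      unfolding x_def y_def z_def det3_mult 0 by simp
    then show False using c by (simp add: vec3_simps)
  qed

  define s1 s2 s3 where "s1 P = y P / z P" and "s2 P = z P / x P" and "s3 P = x P / y P" for P
  have "inj_on s1 S1"
    using same_ratio_imp_eq[OF det r r]
    by (simp add: inj_on_def S s1_def x_def y_def z_def)
  moreover have "inj_on s2 S2"
    using same_ratio_imp_eq[of a2 a3 a1, OF _ r r] det
    by (simp add: inj_on_def S s2_def x_def y_def z_def det3_rotate)
  moreover have "inj_on s3 S3"
    using same_ratio_imp_eq[of a3 a1 a2, OF _ r r] det
    by (simp add: inj_on_def S s3_def x_def y_def z_def det3_rotate[of c for c, symmetric])
  ultimately have card_s: "card (s1 ` S1) = 2" "card (s2 ` S2) = 2" "card (s3 ` S3) = 2"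
    using card2 by (simp_all add: card_image)

  have meet: "L \<inter> S1 \<noteq> {}" "L \<inter> S2 \<noteq> {}" "L \<inter> S3 \<noteq> {}" if L: "L \<in> N" for L
  proof -
    have LN: "is_line L" "card (L \<inter> Z) = 3" using N(2) L by auto
    then have neL: "L \<noteq> L1" "L \<noteq> L2" "L \<noteq> L3" using card4 by (auto simp: A_def B_def C_def)
    have le1: "card ((L \<inter> Z) \<inter> A) \<le> 1" "card ((L \<inter> Z) \<inter> B) \<le> 1" "card ((L \<inter> Z) \<inter> C) \<le> 1"
      unfolding A_def B_def C_def using card_two_lines LN(1) line neL finZ by blast+
    have "(L \<inter> Z) \<inter> S1 \<noteq> {}" "(L \<inter> Z) \<inter> S2 \<noteq> {}" "(L \<inter> Z) \<inter> S3 \<noteq> {}"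
      unfolding S1_def S2_def S3_def
      by (rule transversal_of_triangle[OF LN(2)]; use tri(1) le1 in blast)+
    then show "L \<inter> S1 \<noteq> {}" "L \<inter> S2 \<noteq> {}" "L \<inter> S3 \<noteq> {}" by blast+
  qed
  have "\<exists>w\<in>s3 ` S3. u * v * w = -1" if uv: "u \<in> s1 ` S1" "v \<in> s2 ` S2" for u v
  proof -
    obtain P Q where PQ: "P \<in> S1" "u = s1 P" "Q \<in> S2" "v = s2 Q" using uv by blast
    have "\<exists>L\<in>N. P \<in> L \<and> Q \<in> L"
    proof (rule transversals_cover[OF N(1) card2(1,2) meet(1,2) _ PQ(1,3)])
      fix L L' p q
      assume *: "L \<in> N" "L' \<in> N" "p \<in> L \<inter> L' \<inter> S1" "q \<in> L \<inter> L' \<inter> S2"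
      then have "p \<noteq> q" by (auto simp: S)
      then show "L = L'" using line_unique[of L L' p q] N(2) * by blast
    qed
    then obtain L where L: "L \<in> N" "P \<in> L" "Q \<in> L" by blast
    obtain R where R: "R \<in> L" "R \<in> S3" using meet(3)[OF L(1)] by blast
    have "y P * z Q * x R = - (z P * x Q * y R)"
      unfolding x_def y_def z_def
      using collinear_on_sides[OF _ L(2,3) R(1) r r r] N(2)[OF L(1)] PQ(1,3) R(2) S
      unfolding x_def y_def z_def by blast
    moreover have "u * v * s3 R = (y P * z Q * x R) / (z P * x Q * y R)"
      by (simp add: PQ s1_def s2_def s3_def)
    ultimately have "u * v * s3 R = -1" using PQ(1,3) R(2) by (simp add: S)
    then show ?thesis using R(2) by blast
  qed
  then obtain \<alpha> \<beta> \<gamma> where abc: "\<alpha> * \<beta> * \<gamma> = -1"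
    and sq: "\<forall>u\<in>s1 ` S1. u\<^sup>2 = \<alpha>\<^sup>2" "\<forall>v\<in>s2 ` S2. v\<^sup>2 = \<beta>\<^sup>2" "\<forall>w\<in>s3 ` S3. w\<^sup>2 = \<gamma>\<^sup>2"
    using ratios_up_to_sign[OF card_s] by blast
  have nz: "\<alpha> \<noteq> 0" "\<beta> \<noteq> 0" using abc by auto

  \<comment> \<open>These scalars turn the ratios \<open>\<plusminus>\<alpha>\<close>, \<open>\<plusminus>\<beta>\<close> and \<open>\<plusminus>\<gamma>\<close> into \<open>\<plusminus>1\<close>, for the third one because
    \<open>\<alpha> * \<beta> * \<gamma> = -1\<close>.  The factor \<open>1\<close> matches the shape of \<open>det3_scale\<close>.\<close>
  have coords: "B3_coords (\<alpha> * \<beta> * x P) (1 * y P) (\<alpha> * z P)" if P: "P \<in> Z" for P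
  proof -
    have "x P = 0 \<or> y P = 0 \<or> z P = 0" using P tri(1) by (auto simp: A_def B_def C_def on)
    then consider "x P = 0 \<and> y P = 0" | "x P = 0 \<and> z P = 0" | "y P = 0 \<and> z P = 0"
      | "P \<in> S1" | "P \<in> S2" | "P \<in> S3"
      using P S[of P] by argo
    then show ?thesis
    proof cases
      case 4
      then have "(y P)\<^sup>2 = (\<alpha> * z P)\<^sup>2" using bspec[OF sq(1) imageI[OF 4]] S(1)
        by (simp add: s1_def power_divide power_mult_distrib field_simps)
      then show ?thesis using 4 S(1) by (simp add: B3_coords_def)
    next
      case 5
      then have "(z P)\<^sup>2 = (\<beta> * x P)\<^sup>2" using bspec[OF sq(2) imageI[OF 5]] S(2)
        by (simp add: s2_def power_divide power_mult_distrib field_simps)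
      then have "(\<alpha> * z P)\<^sup>2 = (\<alpha> * \<beta> * x P)\<^sup>2" by (simp add: power_mult_distrib)
      then show ?thesis using 5 S(2) by (simp add: B3_coords_def)
    next
      case 6
      then have "(x P)\<^sup>2 = (\<gamma> * y P)\<^sup>2" using bspec[OF sq(3) imageI[OF 6]] S(3)
        by (simp add: s3_def power_divide power_mult_distrib field_simps)
      then have "(\<alpha> * \<beta> * x P)\<^sup>2 = (\<alpha> * \<beta> * \<gamma> * y P)\<^sup>2" by (simp add: power_mult_distrib)
      then have "(\<alpha> * \<beta> * x P)\<^sup>2 = (y P)\<^sup>2" by (simp add: abc)
      then show ?thesis using 6 S(3) by (simp add: B3_coords_def)
    qed (simp_all add: B3_coords_def)
  qed
  show ?thesis
  proof (intro exI conjI ballI)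
    show "det3 ((\<alpha> * \<beta>) *s a1) (1 *s a2) (\<alpha> *s a3) \<noteq> 0"
      unfolding det3_scale using det nz by simp
    fix P v assume P: "P \<in> Z" and v: "v \<in> reps P"
    obtain c where c: "v = c *s r P" using v reps_eq[OF r] by blast
    show "B3_coords (dot ((\<alpha> * \<beta>) *s a1) v) (dot (1 *s a2) v) (dot (\<alpha> *s a3) v)"
      using B3_coords_scale[OF coords[OF P], of c]
      by (simp add: c dot_scale_left dot_scale_right x_def y_def z_def mult_ac)
  qed
qed

lemma zariski_open_UNIV: "zariski_open (UNIV :: 'a::field proj_plane set)"
proof -
  have "\<not> vanishes_at (Const3 1) (P :: 'a proj_plane)" for P
  proof -
    obtain v where "v \<in> reps P" by (rule reps_nonempty)
    moreover have "eval3 (Const3 1) v = 1"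
      unfolding eval3_eq_subst3 by (rule eval_hom.subst3_Const3)
    ultimately show ?thesis unfolding vanishes_at_def by (metis zero_neq_one)
  qed
  then have "(- UNIV :: 'a proj_plane set) = {P. \<forall>F\<in>{Const3 1}. vanishes_at F P}" by simp
  moreover have "\<forall>F\<in>{Const3 1 :: 'a poly3}. \<exists>d. is_form d F" using is_form_Const3 by blast
  ultimately show ?thesis unfolding zariski_open_def zariski_closed_def
    by (intro exI[of _ "{Const3 1}"] conjI)
qed

theorem mainTheorem4:
  fixes Z :: "'a::field_char_0 proj_plane set"
  assumes "card Z = 9"
    and "\<exists>M N. card M = 3 \<and> (\<forall>L\<in>M. is_line L \<and> card (L \<inter> Z) = 4) \<and>
               card N = 4 \<and> (\<forall>L\<in>N. is_line L \<and> card (L \<inter> Z) = 3)"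
  shows "\<exists>U. zariski_open U \<and> U \<noteq> {} \<and>
    (\<forall>B\<in>U. \<exists>F. F \<noteq> 0 \<and> is_form 4 F \<and> (\<forall>P\<in>Z. vanishes_at F P) \<and>
       vanishes_to_order_at 3 F B)"
proof -
  obtain M N where "card M = 3" "\<And>L. L \<in> M \<Longrightarrow> is_line L \<and> card (L \<inter> Z) = 4"
    "card N = 4" "\<And>L. L \<in> N \<Longrightarrow> is_line L \<and> card (L \<inter> Z) = 3"
    using assms(2) by blast
  with assms(1) have "\<exists>a1 a2 a3 :: 'a^3. det3 a1 a2 a3 \<noteq> 0 \<and>
      (\<forall>P\<in>Z. \<forall>v\<in>reps P. B3_coords (dot a1 v) (dot a2 v) (dot a3 v))"
    by (rule B3_normal_form)
  then obtain a1 a2 a3 :: "'a^3" where "det3 a1 a2 a3 \<noteq> 0"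
    "\<forall>P\<in>Z. \<forall>v\<in>reps P. B3_coords (dot a1 v) (dot a2 v) (dot a3 v)"
    by blast
  then show ?thesis
    by (intro exI[of _ UNIV] conjI ballI zariski_open_UNIV UNIV_not_empty)
      (rule quartic_with_triple_point)
qed

end
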